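(* For all integers $L\geq 1$ and $n\geq 0$, $$ \sum_{m\geq 0}\binom{m}{2}a_2(L,m,n)\ \geq\ \sum_{m\geq 0}\binom{m}{2}b_2(L,m,n). $$
   Context: The hook length of a cell in the Young diagram of a partition is one plus the number of cells to its right in the same row plus the number of cells below it in the same column. A hook of length two means a cell whose hook length equals $2$. For integers $L\ge 1$ and $m,n\ge 0$: $a_2(L,m,n)$ is the number of partitions of $n$ into odd parts (repetitions allowed), each at most $2L-1$, having exactly $m$ hooks of length two; $b_2(L,m,n)$ is the number of partitions of $n$ into distinct parts, each at most $L$, having exactly $m$ hooks of length two. *)

theory Defs
  imports Complex_Main
begin

text \<open>A partition of \<open>n\<close> is the weakly decreasing list of its (positive) parts.\<close>

definition is_partition :: "nat list \<Rightarrow> nat \<Rightarrow> bool" where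
  "is_partition p n \<longleftrightarrow> sorted_wrt (\<ge>) p \<and> (\<forall>x\<in>set p. 0 < x) \<and> sum_list p = n"

text \<open>Cells are pairs (row, column), both counted from 0; rows go downwards.\<close>

definition young_diagram :: "nat list \<Rightarrow> (nat \<times> nat) set" where
  "young_diagram p = {(i, j). i < length p \<and> j < p ! i}"

definition arm_length :: "nat list \<Rightarrow> nat \<times> nat \<Rightarrow> nat" where
  "arm_length p c = card {d \<in> young_diagram p. fst d = fst c \<and> snd c < snd d}"

definition leg_length :: "nat list \<Rightarrow> nat \<times> nat \<Rightarrow> nat" where
  "leg_length p c = card {d \<in> young_diagram p. snd d = snd c \<and> fst c < fst d}"

definition hook_length :: "nat list \<Rightarrow> nat \<times> nat \<Rightarrow> nat" where
  "hook_length p c = 1 + arm_length p c + leg_length p c"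

definition num_hooks :: "nat \<Rightarrow> nat list \<Rightarrow> nat" where
  "num_hooks k p = card {c \<in> young_diagram p. hook_length p c = k}"

text \<open>The truncated subtraction \<open>2 * L - 1\<close> is harmless: only \<open>1 \<le> L\<close> is of interest.\<close>

definition a2 :: "nat \<Rightarrow> nat \<Rightarrow> nat \<Rightarrow> nat" where
  "a2 L m n = card {p. is_partition p n \<and> (\<forall>x\<in>set p. odd x \<and> x \<le> 2 * L - 1) \<and> num_hooks 2 p = m}"

definition b2 :: "nat \<Rightarrow> nat \<Rightarrow> nat \<Rightarrow> nat" where
  "b2 L m n = card {p. is_partition p n \<and> distinct p \<and> (\<forall>x\<in>set p. x \<le> L) \<and> num_hooks 2 p = m}"

text \<open>
  The sets counted above are finite, and \<open>a2 L m n\<close> and \<open>b2 L m n\<close> vanish for \<open>m > n\<close>,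
  so that the series over \<open>m\<close> are finite sums.
\<close>

lemma finite_partitions: "finite {p. is_partition p n}"
proof (rule finite_subset)
  have len: "length p \<le> sum_list p" if "\<forall>x\<in>set p. 0 < x" for p :: "nat list"
    using that by (induction p) auto
  show "{p. is_partition p n} \<subseteq> {p. set p \<subseteq> {..n} \<and> length p \<le> n}"
    using len by (auto simp: is_partition_def intro: member_le_sum_list)
  show "finite {p. set p \<subseteq> {..n} \<and> length p \<le> n}"
    by (rule finite_lists_length_le) simp
qed

lemma young_diagram_Sigma: "young_diagram p = Sigma {..<length p} (\<lambda>i. {..<p ! i})"
  by (auto simp: young_diagram_def)

lemma finite_young_diagram: "finite (young_diagram p)"
  by (simp add: young_diagram_Sigma)

lemma card_young_diagram: "card (young_diagram p) = sum_list p"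
  by (simp add: young_diagram_Sigma sum_list_sum_nth atLeast0LessThan)

lemma num_hooks_le: "num_hooks k p \<le> sum_list p"
  unfolding num_hooks_def card_young_diagram[symmetric]
  by (rule card_mono[OF finite_young_diagram]) auto

lemma num_hooks_neq: "n < m \<Longrightarrow> is_partition p n \<Longrightarrow> num_hooks k p \<noteq> m"
  using num_hooks_le[of k p] by (simp add: is_partition_def)

lemma a2_eq_0: "n < m \<Longrightarrow> a2 L m n = 0"
  by (auto simp: a2_def card_eq_0_iff dest: num_hooks_neq)

lemma b2_eq_0: "n < m \<Longrightarrow> b2 L m n = 0"
  by (auto simp: b2_def card_eq_0_iff dest: num_hooks_neq)

end

theory Submission
  imports Defs "HOL-Computational_Algebra.Formal_Power_Series" "HOL-Library.Multiset"
begin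

text \<open>
  In a partition into distinct parts the hooks of length two correspond to the parts \<open>s \<ge> 2\<close> such
  that \<open>s - 1\<close> is not a part. Let \<open>B\<^sub>j(L)\<close> be the generating function counting partitions into distinct
  parts at most \<open>L\<close> together with \<open>j\<close> marked such parts, and \<open>D(L) = B\<^sub>0(L)\<close>. Distinguishing whether
  \<open>L\<close> and \<open>L - 1\<close> are parts gives \<open>B\<^sub>j(L) = (1 + q\<^sup>L) B\<^sub>j(L - 1) + q\<^sup>L B\<^sub>j\<^sub>-\<^sub>1(L - 2)\<close>, whence
  \<open>B\<^sub>2(L) = q\<^sup>6 D(L - 2) (1 - q\<^bsup>L-2\<^esup>) (1 - q\<^bsup>L-3\<^esup>) / ((1 - q\<^sup>2) (1 - q\<^sup>4))\<close>.

  In a partition into odd parts each part size at least 3 gives a hook of length two, and a second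
  one if it is repeated. So the number of pairs of hooks is at least the number of two-element
  submultisets of the parts that are at least 3. If \<open>P(L)\<close> is the generating function of partitions
  into odd parts at most \<open>2L - 1\<close>, these are counted by \<open>P(L) h\<^sub>2(q\<^sup>3, q\<^sup>5, \<dots>, q\<^bsup>2L-1\<^esup>)\<close>, where
  \<open>h\<^sub>2 = q\<^sup>6 (1 - q\<^bsup>2L-2\<^esup>) (1 - q\<^bsup>2L\<^esup>) / ((1 - q\<^sup>2) (1 - q\<^sup>4))\<close> is the complete homogeneous polynomial.
  Since \<open>P(L) = D(L) / ((1 - q\<^bsup>L+1\<^esup>) \<cdots> (1 - q\<^bsup>2L\<^esup>))\<close>, for \<open>L \<ge> 3\<close> the numerator of \<open>h\<^sub>2\<close> cancels
  against two of these factors, and the first series dominates the second coefficientwise.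
\<close>

section \<open>Hooks of length two\<close>

lemma arm_length_eq: "i < length p \<Longrightarrow> arm_length p (i, j) = p ! i - Suc j"
proof -
  assume "i < length p"
  then have "{d \<in> young_diagram p. fst d = fst (i, j) \<and> snd (i, j) < snd d} = {i} \<times> {j<..<p ! i}"
    by (auto simp: young_diagram_def)
  then show ?thesis
    by (simp add: arm_length_def card_cartesian_product)
qed

lemma leg_length_eq: "leg_length p (i, j) = card {k. i < k \<and> k < length p \<and> j < p ! k}"
proof -
  have "{d \<in> young_diagram p. snd d = snd (i, j) \<and> fst (i, j) < fst d}
      = {k. i < k \<and> k < length p \<and> j < p ! k} \<times> {j}"
    by (auto simp: young_diagram_def)
  then show ?thesis
    by (simp add: leg_length_def card_cartesian_product)
qed

text \<open>The bound \<open>2 \<le> s\<close> excludes a run beginning at 1: its predecessor 0 is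
  never a part, yet a row of length 1 has no cell with arm 1.\<close>

definition run_starts :: "nat set \<Rightarrow> nat set" where
  "run_starts S = {s \<in> S. 2 \<le> s \<and> s - 1 \<notin> S}"

text \<open>Lower rows are strictly shorter, so arm 0 forces leg 0. A hook of length two thus has
  arm 1 and leg 0, and the empty leg means that no row is shorter by exactly one.\<close>

lemma num_hooks_distinct_le:
  assumes "sorted_wrt (\<ge>) p" "distinct p"
  shows "num_hooks 2 p \<le> card (run_starts (set p))"
proof -
  let ?H = "{c \<in> young_diagram p. hook_length p c = 2}"
  have H: "j = p ! i - 2 \<and> 2 \<le> p ! i \<and> p ! i - 1 \<notin> set p \<and> i < length p" if "(i, j) \<in> ?H" for i j
  proof -
    let ?K = "{k. i < k \<and> k < length p \<and> j < p ! k}"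
    have i: "i < length p" and j: "j < p ! i" and h: "p ! i - Suc j + card ?K = 1"
      using that by (auto simp: young_diagram_def hook_length_def arm_length_eq leg_length_eq)
    have less: "p ! k < p ! i" if "i < k" "k < length p" for k
      using sorted_wrt_nth_less[OF assms(1) that] nth_eq_iff_index_eq[OF assms(2), of k i] that i
      by (simp add: order.strict_iff_order)
    have "p ! i - Suc j \<noteq> 0"
    proof
      assume "p ! i - Suc j = 0"
      then have "?K = {}" using less j by fastforce
      with h \<open>p ! i - Suc j = 0\<close> show False by simp
    qed
    then have "p ! i - Suc j = 1" and "card ?K = 0" using h by linarith+
    then have j2: "p ! i = j + 2" by simp
    have K: "?K = {}" using \<open>card ?K = 0\<close> by (simp add: card_eq_0_iff)
    have "p ! i - 1 \<notin> set p"
    proof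
      assume "p ! i - 1 \<in> set p"
      then obtain k where k: "k < length p" "p ! k = p ! i - 1" by (auto simp: in_set_conv_nth)
      have "i < k"
      proof (rule ccontr)
        assume "\<not> i < k"
        then consider "k = i" | "k < i" by linarith
        then show False
          using sorted_wrt_nth_less[OF assms(1) _ i, of k] k j by cases auto
      qed
      then have "k \<in> ?K" using k j2 by auto
      with K show False by blast
    qed
    then show ?thesis using j2 i by auto
  qed
  have "card ?H \<le> card (run_starts (set p))"
  proof (rule card_inj_on_le)
    show "inj_on (\<lambda>c. p ! fst c) ?H"
    proof (rule inj_onI, clarify)
      fix i j i' j'
      assume *: "(i, j) \<in> young_diagram p" "hook_length p (i, j) = 2"
        "(i', j') \<in> young_diagram p" "hook_length p (i', j') = 2" and eq: "p ! fst (i, j) = p ! fst (i', j')"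
      then have "j = p ! i - 2" "i < length p" "j' = p ! i' - 2" "i' < length p"
        using H by blast+
      then show "i = i' \<and> j = j'" using eq assms(2) by (simp add: nth_eq_iff_index_eq)
    qed
    show "(\<lambda>c. p ! fst c) ` ?H \<subseteq> run_starts (set p)"
      using H by (fastforce simp: run_starts_def)
    show "finite (run_starts (set p))" by (simp add: run_starts_def)
  qed
  then show ?thesis by (simp add: num_hooks_def)
qed

definition large_parts :: "nat multiset \<Rightarrow> nat set" where
  "large_parts M = {s \<in> set_mset M. 3 \<le> s}"

text \<open>A repeated part 1 also gives a hook of length two; leaving it out preserves the lower
  bound and matches the variables q^3, q^5, ... of \<open>h\<^sub>2\<close>.\<close>

definition repeated_parts :: "nat multiset \<Rightarrow> nat set" where
  "repeated_parts M = {s \<in> set_mset M. 3 \<le> s \<and> 2 \<le> count M s}"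

lemma finite_large_parts [simp]: "finite (large_parts M)"
  by (simp add: large_parts_def)

lemma finite_repeated_parts [simp]: "finite (repeated_parts M)"
  by (simp add: repeated_parts_def)

text \<open>By parity, a row after the last row of length \<open>s\<close> is shorter by at least
  two, so the cell of that last row in column \<open>s - 2\<close> has arm 1 and leg 0. If
  \<open>s\<close> is repeated, the end of the row just above has arm 0 and leg 1.\<close>

lemma num_hooks_odd_ge:
  assumes sorted: "sorted_wrt (\<ge>) p" and odd: "\<And>x. x \<in> set p \<Longrightarrow> odd x"
  shows "card (large_parts (mset p) <+> repeated_parts (mset p)) \<le> num_hooks 2 p"
proof -
  define m where "m s = Max {i. i < length p \<and> p ! i = s}" for s
  have m: "m s < length p \<and> p ! m s = s \<and> (\<forall>k. m s < k \<and> k < length p \<longrightarrow> p ! k + 2 \<le> s)"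
    if s: "s \<in> set p" for s
  proof -
    have ne: "{i. i < length p \<and> p ! i = s} \<noteq> {}" using s by (auto simp: in_set_conv_nth)
    have 1: "m s \<in> {i. i < length p \<and> p ! i = s}"
      unfolding m_def by (rule Max_in) (use ne in auto)
    moreover have "p ! k + 2 \<le> s" if k: "m s < k" "k < length p" for k
    proof -
      have "p ! k \<noteq> s"
      proof
        assume "p ! k = s"
        then have "k \<le> m s" unfolding m_def using k by (intro Max_ge) auto
        then show False using k by simp
      qed
      moreover have "p ! k \<le> s" using sorted_wrt_nth_less[OF sorted k] 1 by simp
      moreover have "odd (p ! k)" "odd s" using odd s k by auto
      ultimately show ?thesis by presburger
    qed
    ultimately show ?thesis by blast
  qed
  have rep: "0 < m s \<and> p ! (m s - 1) = s" if s: "s \<in> repeated_parts (mset p)" for s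
  proof -
    have s': "s \<in> set p" using s by (auto simp: repeated_parts_def)
    let ?I = "{i. i < length p \<and> p ! i = s}"
    have "count (mset p) s = card ?I"
      unfolding count_mset count_list_eq_length_filter length_filter_conv_card
      by (rule arg_cong[of _ _ card]) auto
    then have "2 \<le> card ?I" using s by (simp add: repeated_parts_def)
    \<comment> \<open>Another row of length \<open>s\<close> precedes row \<open>m s\<close>;
      sortedness then squeezes row \<open>m s - 1\<close> to the same length.\<close>
    then have "\<not> ?I \<subseteq> {m s}"
      using card_mono[of "{m s}" ?I] by auto
    then obtain i where i: "i < length p" "p ! i = s" "i \<noteq> m s" by auto
    then have lt: "i < m s" using m[OF s'] by (metis add_le_same_cancel1 linorder_neqE_nat not_numeral_le_zero)
    then have "s \<le> p ! (m s - 1)" using sorted_wrt_nth_less[OF sorted, of "m s - 1" "m s"] m[OF s'] by simp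
    moreover have "p ! (m s - 1) \<le> s"
      using sorted_wrt_nth_less[OF sorted, of i "m s - 1"] m[OF s'] i lt
      by (cases "i = m s - 1") auto
    ultimately show ?thesis using lt by auto
  qed
  let ?f = "case_sum (\<lambda>s. (m s, s - 2)) (\<lambda>s. (m s - 1, s - 1))"
  have "card (large_parts (mset p) <+> repeated_parts (mset p))
      \<le> card {c \<in> young_diagram p. hook_length p c = 2}"
  proof (rule card_inj_on_le)
    \<comment> \<open>A common cell would lie in a row of length \<open>s = s'\<close>, but the
      columns \<open>s - 2\<close> and \<open>s - 1\<close> differ.\<close>
    have mixed: "(m s, s - 2) \<noteq> (m s' - 1, s' - 1)"
      if "s \<in> large_parts (mset p)" "s' \<in> repeated_parts (mset p)" for s s'
    proof
      assume eq: "(m s, s - 2) = (m s' - 1, s' - 1)"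
      have s: "s \<in> set p" "3 \<le> s" using that(1) by (auto simp: large_parts_def)
      have "m s = m s' - 1" "s - 2 = s' - 1" using eq by auto
      moreover from this have "s = s'" using m[OF s(1)] rep[OF that(2)] by metis
      ultimately show False using s(2) by linarith
    qed
    show "inj_on ?f (large_parts (mset p) <+> repeated_parts (mset p))"
    proof (rule inj_onI, elim PlusE; hypsubst; simp only: sum.case sum.inject)
      fix s s' assume "s \<in> large_parts (mset p)" "s' \<in> large_parts (mset p)" "(m s, s - 2) = (m s', s' - 2)"
      then show "s = s'" by (auto simp: large_parts_def)
    next
      fix s s' assume "s \<in> repeated_parts (mset p)" "s' \<in> repeated_parts (mset p)"
        "(m s - 1, s - 1) = (m s' - 1, s' - 1)"
      then show "s = s'" by (auto simp: repeated_parts_def)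
    qed (use mixed in fastforce)+
    have "(m s, s - 2) \<in> young_diagram p \<and> hook_length p (m s, s - 2) = 2"
      if "s \<in> large_parts (mset p)" for s
    proof -
      have s: "s \<in> set p" "3 \<le> s" using that by (auto simp: large_parts_def)
      have "{k. m s < k \<and> k < length p \<and> s - 2 < p ! k} = {}"
        using m[OF s(1)] by fastforce
      then show ?thesis using m[OF s(1)] s
        by (auto simp: young_diagram_def hook_length_def arm_length_eq leg_length_eq)
    qed
    moreover have "(m s - 1, s - 1) \<in> young_diagram p \<and> hook_length p (m s - 1, s - 1) = 2"
      if "s \<in> repeated_parts (mset p)" for s
    proof -
      have s: "s \<in> set p" "3 \<le> s" using that by (auto simp: repeated_parts_def)
      have "{k. m s - 1 < k \<and> k < length p \<and> s - 1 < p ! k} = {m s}"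
      proof (intro equalityI subsetI)
        fix k assume k: "k \<in> {k. m s - 1 < k \<and> k < length p \<and> s - 1 < p ! k}"
        then have "\<not> m s < k" using m[OF s(1)] by fastforce
        moreover have "m s - 1 < k" "0 < m s" using k rep[OF that] by auto
        ultimately have "k = m s" by linarith
        then show "k \<in> {m s}" by simp
      next
        fix k assume "k \<in> {m s}"
        then show "k \<in> {k. m s - 1 < k \<and> k < length p \<and> s - 1 < p ! k}"
          using m[OF s(1)] rep[OF that] s(2) by simp
      qed
      then show ?thesis using m[OF s(1)] rep[OF that] s
        by (auto simp: young_diagram_def hook_length_def arm_length_eq leg_length_eq)
    qed
    ultimately show "?f ` (large_parts (mset p) <+> repeated_parts (mset p))
        \<subseteq> {c \<in> young_diagram p. hook_length p c = 2}"
      by auto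
    show "finite {c \<in> young_diagram p. hook_length p c = 2}"
      by (simp add: finite_young_diagram)
  qed
  then show ?thesis by (simp add: num_hooks_def)
qed

section \<open>Power series with nonnegative coefficients\<close>

definition nonneg :: "int fps \<Rightarrow> bool" where
  "nonneg f \<longleftrightarrow> (\<forall>n. 0 \<le> fps_nth f n)"

lemma nonneg_add: "nonneg f \<Longrightarrow> nonneg g \<Longrightarrow> nonneg (f + g)"
  by (simp add: nonneg_def)

lemma nonneg_mult: "nonneg f \<Longrightarrow> nonneg g \<Longrightarrow> nonneg (f * g)"
  by (auto simp: nonneg_def fps_mult_nth intro!: sum_nonneg)

lemma nonneg_one: "nonneg 1"
  by (simp add: nonneg_def)

lemma nonneg_X_power: "nonneg (fps_X ^ k)"
  by (simp add: nonneg_def fps_X_power_nth)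

lemma nonneg_sum: "(\<And>x. x \<in> A \<Longrightarrow> nonneg (f x)) \<Longrightarrow> nonneg (sum f A)"
  by (simp add: nonneg_def fps_sum_nth sum_nonneg)

lemma nonneg_prod: "(\<And>x. x \<in> A \<Longrightarrow> nonneg (f x)) \<Longrightarrow> nonneg (prod f A)"
  by (induction A rule: infinite_finite_induct) (auto intro: nonneg_mult nonneg_one)

lemmas nonneg_intros = nonneg_add nonneg_mult nonneg_one nonneg_X_power nonneg_sum nonneg_prod

text \<open>With g = f (1 - q^j), the coefficients satisfy f_n = g_n + f_(n-j), so nonnegativity
  propagates upwards.\<close>

lemma nonneg_cancel:
  assumes "nonneg (f * (1 - fps_X ^ j))" "0 < j"
  shows "nonneg f"
proof -
  have "0 \<le> fps_nth f n" for n
  proof (induction n rule: less_induct)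
    case (less n)
    have "f * (1 - fps_X ^ j) = f - fps_X ^ j * f" by (simp add: algebra_simps)
    then have "0 \<le> fps_nth (f - fps_X ^ j * f) n"
      using assms(1) by (metis nonneg_def)
    then show ?case
      using less.IH[of "n - j"] assms(2) by (simp add: fps_X_power_mult_nth split: if_splits)
  qed
  then show ?thesis by (simp add: nonneg_def)
qed

text \<open>Each factor lowers f by f - f (1 - q^j) = q^j f; \<open>nonneg_cancel\<close> makes this
  nonnegative at every stage, starting from the full product.\<close>

lemma nonneg_diff_prod:
  assumes "finite J" "0 \<notin> J" "nonneg (f * (\<Prod>j\<in>J. 1 - fps_X ^ j))"
  shows "nonneg (f - f * (\<Prod>j\<in>J. 1 - fps_X ^ j)) \<and> nonneg f"
  using assms
proof (induction J arbitrary: f rule: finite_induct)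
  case empty
  then show ?case by (simp add: nonneg_def)
next
  case (insert j J)
  let ?g = "f * (1 - fps_X ^ j)"
  have eq: "f * (\<Prod>j\<in>insert j J. 1 - fps_X ^ j) = ?g * (\<Prod>j\<in>J. 1 - fps_X ^ j)"
    using insert.hyps by (simp add: mult.assoc)
  have g: "nonneg (?g - ?g * (\<Prod>j\<in>J. 1 - fps_X ^ j))" "nonneg ?g"
    using insert.IH[of ?g] insert.prems eq by auto
  then have f: "nonneg f" using nonneg_cancel insert.prems by (metis insertCI neq0_conv)
  have "f * fps_X ^ j + (?g - P) = f - P" for P
    by (simp add: algebra_simps)
  moreover have "nonneg (f * fps_X ^ j + (?g - ?g * (\<Prod>j\<in>J. 1 - fps_X ^ j)))"
    using f g by (intro nonneg_intros)
  ultimately show ?case using f unfolding eq by metis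
qed

section \<open>Partitions into distinct parts\<close>

text \<open>This is \<open>B\<^sub>j(L)\<close>: the binomial coefficient counts the choices of
  \<open>j\<close> marked run starts.\<close>

definition run_fps :: "nat \<Rightarrow> nat \<Rightarrow> int fps" where
  "run_fps j L = (\<Sum>S\<in>Pow {1..L}. of_nat (card (run_starts S) choose j) * fps_X ^ (\<Sum>S))"

abbreviation distinct_fps :: "nat \<Rightarrow> int fps" where
  "distinct_fps \<equiv> run_fps 0"

lemma finite_run_starts [simp]: "finite S \<Longrightarrow> finite (run_starts S)"
  by (simp add: run_starts_def)

lemma sum_Pow_Suc:
  "(\<Sum>S\<in>Pow {1..Suc L}. f S) = (\<Sum>S\<in>Pow {1..L}. f S) + (\<Sum>S\<in>Pow {1..L}. f (insert (Suc L) S))"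
proof -
  have "inj_on (insert (Suc L)) (Pow {1..L})"
  proof (rule inj_onI)
    fix S T assume "S \<in> Pow {1..L}" "T \<in> Pow {1..L}" "insert (Suc L) S = insert (Suc L) T"
    moreover from this have "Suc L \<notin> S" "Suc L \<notin> T" by auto
    ultimately show "S = T" by (simp add: insert_ident)
  qed
  moreover have "Pow {1..L} \<inter> insert (Suc L) ` Pow {1..L} = {}" by auto
  moreover have "Pow {1..Suc L} = Pow {1..L} \<union> insert (Suc L) ` Pow {1..L}"
    by (simp add: atLeastAtMostSuc_conv Pow_insert)
  ultimately show ?thesis by (simp add: sum.union_disjoint sum.reindex)
qed

lemma sum_insert_Suc:
  assumes "S \<in> Pow {1..L}"
  shows "\<Sum>(insert (Suc L) S) = Suc L + \<Sum>S"
  using assms finite_subset[of S "{1..L}"] by (subst sum.insert) auto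

lemma distinct_fps_Suc: "distinct_fps (Suc L) = distinct_fps L * (1 + fps_X ^ Suc L)"
  unfolding run_fps_def sum_Pow_Suc
  by (simp add: sum_insert_Suc distrib_left sum_distrib_right power_add[symmetric] add_ac
      del: sum.insert power_Suc)

lemma distinct_fps_0: "distinct_fps 0 = 1"
  by (simp add: run_fps_def)

lemma nonneg_distinct_fps: "nonneg (distinct_fps L)"
  by (induction L) (auto simp: distinct_fps_0 distinct_fps_Suc intro!: nonneg_intros simp del: power_Suc)

lemma run_starts_insert_Suc:
  assumes "S \<subseteq> {1..Suc L}"
  shows "run_starts (insert (Suc (Suc L)) S)
    = (if Suc L \<in> S then run_starts S else insert (Suc (Suc L)) (run_starts S))"
  using assms by (auto simp: run_starts_def)

text \<open>Adjoining the new maximum \<open>L + 2\<close> creates a run start exactly when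
  \<open>L + 1\<close> is absent. Pascal's rule splits off the choices that mark it, and these range
  over the subsets of \<open>{1..L}\<close>.\<close>

lemma run_fps_Suc_Suc:
  "run_fps (Suc j) (Suc (Suc L))
    = (1 + fps_X ^ (L + 2)) * run_fps (Suc j) (Suc L) + fps_X ^ (L + 2) * run_fps j L"
proof -
  let ?w = "\<lambda>j S. of_nat (card (run_starts S) choose j) * fps_X ^ (\<Sum>S) :: int fps"
  let ?q = "fps_X ^ (L + 2) :: int fps"
  have step: "?w (Suc j) (insert (Suc (Suc L)) S)
      = ?q * ?w (Suc j) S + (if Suc L \<in> S then 0 else ?q * ?w j S)" if S: "S \<in> Pow {1..Suc L}" for S
  proof -
    have fin: "finite S" using S finite_subset by auto
    have "Suc (Suc L) \<notin> run_starts S" using S by (auto simp: run_starts_def)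
    then show ?thesis
      using S fin by (simp add: sum_insert_Suc run_starts_insert_Suc power_add algebra_simps
          del: sum.insert)
  qed
  have "(\<Sum>S\<in>Pow {1..Suc L}. if Suc L \<in> S then 0 else ?q * ?w j S)
      = (\<Sum>S\<in>Pow {1..L}. ?q * ?w j S)"
    by (rule sum.mono_neutral_cong_right) (auto simp: atLeastAtMostSuc_conv)
  then have "run_fps (Suc j) (Suc (Suc L)) = run_fps (Suc j) (Suc L)
      + (?q * run_fps (Suc j) (Suc L) + ?q * run_fps j L)"
    unfolding run_fps_def sum_Pow_Suc[of _ "Suc L"]
    by (simp add: step sum.distrib sum_distrib_left del: power_Suc)
  then show ?thesis by (simp add: algebra_simps)
qed

lemma run_fps_small: "L \<le> 1 \<Longrightarrow> run_fps (Suc j) L = 0"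
  unfolding run_fps_def
proof (rule sum.neutral, rule ballI)
  fix S assume "L \<le> 1" "S \<in> Pow {1..L}"
  then have "run_starts S = {}" by (fastforce simp: run_starts_def)
  then show "of_nat (card (run_starts S) choose Suc j) * fps_X ^ (\<Sum>S) = (0 :: int fps)" by simp
qed

lemma run_fps_1: "(1 - fps_X ^ 2) * run_fps 1 (Suc L) = distinct_fps L * fps_X ^ 2 * (1 - fps_X ^ L)"
proof (induction L)
  case 0
  then show ?case by (simp add: run_fps_small)
next
  case (Suc L)
  \<comment> \<open>Here \<open>y\<close> stands for q^L, \<open>B\<close> for
    \<open>run_fps 1 (Suc L)\<close> and \<open>D\<close> for \<open>distinct_fps L\<close>.\<close>
  have alg: "(1 - q\<^sup>2) * ((1 + y * q\<^sup>2) * B + y * q\<^sup>2 * D) = D * (1 + q * y) * q\<^sup>2 * (1 - q * y)"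
    if "(1 - q\<^sup>2) * B = D * q\<^sup>2 * (1 - y)" for q y B D :: "int fps"
    using that by algebra
  show ?case
    using alg[OF Suc] unfolding One_nat_def run_fps_Suc_Suc distinct_fps_Suc
    by (simp add: power_add power2_eq_square mult_ac)
qed

text \<open>The recurrence for two marks is fed with the closed form for one. The shift by 3 keeps
  all exponents free of truncated subtraction.\<close>

lemma run_fps_2:
  "(1 - fps_X ^ 2) * (1 - fps_X ^ 4) * run_fps 2 (L + 3)
    = fps_X ^ 6 * distinct_fps (Suc L) * (1 - fps_X ^ Suc L) * (1 - fps_X ^ L)"
proof (induction L)
  case 0
  then show ?case
    using run_fps_Suc_Suc[of 1 0] run_fps_Suc_Suc[of 1 1]
    by (simp add: run_fps_small numeral_2_eq_2 numeral_3_eq_3)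
next
  case (Suc L)
  have alg: "(1 - q\<^sup>2) * (1 - q ^ 4) * ((1 + y * q ^ 4) * B + y * q ^ 4 * C)
      = q ^ 6 * (D * (1 + q\<^sup>2 * y)) * (1 - q\<^sup>2 * y) * (1 - q * y)"
    if "(1 - q\<^sup>2) * (1 - q ^ 4) * B = q ^ 6 * D * (1 - q * y) * (1 - y)"
      "(1 - q\<^sup>2) * C = D * q\<^sup>2 * (1 - q * y)" for q y B C D :: "int fps"
    using that by algebra
  have "run_fps 2 (Suc L + 3) = (1 + fps_X ^ L * fps_X ^ 4) * run_fps 2 (L + 3)
      + fps_X ^ L * fps_X ^ 4 * run_fps 1 (L + 2)"
    using run_fps_Suc_Suc[of 1 "L + 2"]
    by (simp add: numeral_2_eq_2 numeral_3_eq_3 power_add[symmetric] eval_nat_numeral)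
  moreover have "distinct_fps (Suc (Suc L)) = distinct_fps (Suc L) * (1 + fps_X\<^sup>2 * fps_X ^ L)"
    by (simp add: distinct_fps_Suc[of "Suc L"] power2_eq_square mult.assoc)
  moreover have "fps_X ^ Suc (Suc L) = fps_X\<^sup>2 * (fps_X ^ L :: int fps)"
    by (simp add: power2_eq_square mult.assoc)
  ultimately show ?case
    using alg[of fps_X "run_fps 2 (L + 3)" "distinct_fps (Suc L)" "fps_X ^ L" "run_fps 1 (L + 2)"]
      Suc run_fps_1[of "Suc L"] by simp
qed

section \<open>Partitions into odd parts\<close>

text \<open>With multisets, prescribed parts can be added or removed without regard to
  order.\<close>

definition odd_msets :: "nat \<Rightarrow> nat \<Rightarrow> nat multiset set" where
  "odd_msets L n = {M. set_mset M \<subseteq> {x. odd x \<and> x \<le> 2 * L - 1} \<and> \<Sum>\<^sub># M = n}"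

definition odd_fps :: "nat \<Rightarrow> int fps" where
  "odd_fps L = Abs_fps (\<lambda>n. int (card (odd_msets L n)))"

definition odd_partitions :: "nat \<Rightarrow> nat \<Rightarrow> nat list set" where
  "odd_partitions L n = {p. is_partition p n \<and> (\<forall>x\<in>set p. odd x \<and> x \<le> 2 * L - 1)}"

lemma finite_odd_partitions: "finite (odd_partitions L n)"
  by (rule finite_subset[OF _ finite_partitions[of n]]) (auto simp: odd_partitions_def)

lemma inj_on_mset_partitions: "inj_on mset {p. is_partition p n}"
proof (rule inj_onI)
  fix p p' assume "p \<in> {p. is_partition p n}" "p' \<in> {p. is_partition p n}" "mset p = mset p'"
  then have "sorted (rev p)" "sorted (rev p')" "mset (rev p) = mset (rev p')"
    by (auto simp: is_partition_def sorted_wrt_rev)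
  then have "rev p = rev p'" by (metis properties_for_sort)
  then show "p = p'" by simp
qed

lemma mset_odd_partitions: "mset ` odd_partitions L n = odd_msets L n"
proof (intro equalityI subsetI)
  fix M assume M: "M \<in> odd_msets L n"
  let ?p = "rev (sorted_list_of_multiset M)"
  have "mset ?p = M" by simp
  moreover have "?p \<in> odd_partitions L n"
    using M sum_mset_sum_list[of ?p]
    by (auto simp: odd_msets_def odd_partitions_def is_partition_def sorted_wrt_rev
        sorted_sorted_list_of_multiset sum_mset_sum_list intro: odd_pos)
  ultimately show "M \<in> mset ` odd_partitions L n" by (metis imageI)
qed (auto simp: odd_msets_def odd_partitions_def is_partition_def sum_mset_sum_list)

lemma finite_odd_msets: "finite (odd_msets L n)"
  by (simp add: mset_odd_partitions[symmetric] finite_odd_partitions)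

text \<open>Adding \<open>N\<close> is a bijection onto the multisets that contain \<open>N\<close>,
  and it raises the total by the exponent of the monomial.\<close>

lemma card_odd_msets_supset:
  assumes "set_mset N \<subseteq> {x. odd x \<and> x \<le> 2 * L - 1}"
  shows "int (card {M \<in> odd_msets L n. N \<subseteq># M}) = fps_nth (fps_X ^ (\<Sum>\<^sub># N) * odd_fps L) n"
proof (cases "n < \<Sum>\<^sub># N")
  case True
  have "{M \<in> odd_msets L n. N \<subseteq># M} = {}"
    using True by (auto simp: odd_msets_def mset_subset_eq_exists_conv)
  then have "card {M \<in> odd_msets L n. N \<subseteq># M} = 0" by (simp only: card.empty)
  then show ?thesis using True by (simp add: fps_X_power_mult_nth)
next
  case False
  have "{M \<in> odd_msets L n. N \<subseteq># M} = (+) N ` odd_msets L (n - \<Sum>\<^sub># N)"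
    using assms False by (auto simp: odd_msets_def image_iff mset_subset_eq_exists_conv)
  then have "card {M \<in> odd_msets L n. N \<subseteq># M} = card (odd_msets L (n - \<Sum>\<^sub># N))"
    by (simp add: card_image)
  then show ?thesis using False by (simp add: fps_X_power_mult_nth odd_fps_def)
qed

lemma odd_fps_0: "odd_fps 0 = 1"
proof -
  have "odd_msets 0 n = (if n = 0 then {{#}} else {})" for n
  proof -
    \<comment> \<open>The truncated bound is 0, which is even.\<close>
    have "{x. odd x \<and> x \<le> 2 * 0 - 1} = ({} :: nat set)" by (auto elim: oddE)
    then have "odd_msets 0 n = {M. M = {#} \<and> \<Sum>\<^sub># M = n}"
      unfolding odd_msets_def by (simp only: subset_empty set_mset_eq_empty_iff)
    then show ?thesis by auto
  qed
  then show ?thesis by (simp add: odd_fps_def fps_eq_iff)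
qed

text \<open>Either the part \<open>2 * L + 1\<close> does not occur, or one copy of it can be
  removed.\<close>

lemma odd_fps_Suc: "odd_fps (Suc L) * (1 - fps_X ^ (2 * L + 1)) = odd_fps L"
proof -
  let ?N = "{#2 * L + 1#}"
  have "odd_fps (Suc L) = odd_fps L + fps_X ^ (2 * L + 1) * odd_fps (Suc L)"
  proof (rule fps_ext)
    fix n
    have "odd x \<and> x \<le> 2 * Suc L - 1 \<longleftrightarrow> x = 2 * L + 1 \<or> odd x \<and> x \<le> 2 * L - 1" for x
      by presburger
    then have *: "{x. odd x \<and> x \<le> 2 * Suc L - 1} = insert (2 * L + 1) {x. odd x \<and> x \<le> 2 * L - 1}"
      by blast
    have "odd_msets (Suc L) n = odd_msets L n \<union> {M \<in> odd_msets (Suc L) n. ?N \<subseteq># M}"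
      unfolding odd_msets_def * single_subset_iff by blast
    moreover have "odd_msets L n \<inter> {M \<in> odd_msets (Suc L) n. ?N \<subseteq># M} = {}"
      unfolding odd_msets_def single_subset_iff by fastforce
    ultimately have "card (odd_msets (Suc L) n)
        = card (odd_msets L n) + card {M \<in> odd_msets (Suc L) n. ?N \<subseteq># M}"
      using card_Un_disjoint[of "odd_msets L n" "{M \<in> odd_msets (Suc L) n. ?N \<subseteq># M}"]
      by (simp add: finite_odd_msets)
    then show "fps_nth (odd_fps (Suc L)) n
        = fps_nth (odd_fps L + fps_X ^ (2 * L + 1) * odd_fps (Suc L)) n"
      using card_odd_msets_supset[of ?N "Suc L" n] by (simp add: odd_fps_def)
  qed
  then show ?thesis by (simp add: algebra_simps)
qed

lemma one_minus_X_power_neq_0: "0 < j \<Longrightarrow> 1 - fps_X ^ j \<noteq> (0 :: int fps)"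
  by (metis diff_zero fps_sub_nth fps_X_power_nth fps_one_nth fps_zero_nth neq0_conv zero_neq_one)

text \<open>A finite form of Euler's theorem on odd and distinct parts. From \<open>L\<close> to
  \<open>Suc L\<close> the product loses the exponent L+1 and gains 2L+1 and 2L+2; the former gain
  is absorbed by \<open>odd_fps_Suc\<close>, and 1 - q^(2L+2) = (1 - q^(L+1)) (1 + q^(L+1)).\<close>

lemma odd_fps_eq_distinct_fps: "odd_fps L * (\<Prod>j\<in>{L<..2 * L}. 1 - fps_X ^ j) = distinct_fps L"
proof (induction L)
  case 0
  then show ?case by (simp add: odd_fps_0 distinct_fps_0)
next
  case (Suc L)
  let ?f = "\<lambda>j. 1 - fps_X ^ j :: int fps"
  \<comment> \<open>The extra factor restores the lost exponent L+1; it is cancelled at the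
    end.\<close>
  have "?f (Suc L) * (odd_fps (Suc L) * (\<Prod>j\<in>{Suc L<..2 * Suc L}. ?f j))
      = odd_fps (Suc L) * (\<Prod>j\<in>insert (Suc L) {Suc L<..2 * Suc L}. ?f j)"
    by (simp add: mult.left_commute del: power_Suc)
  also have "insert (Suc L) {Suc L<..2 * Suc L} = insert (2 * L + 1) (insert (2 * Suc L) {L<..2 * L})"
    by auto
  also have "odd_fps (Suc L) * (\<Prod>j\<in>\<dots>. ?f j)
      = odd_fps (Suc L) * ?f (2 * L + 1) * (\<Prod>j\<in>{L<..2 * L}. ?f j) * ?f (2 * Suc L)"
    by (simp add: mult_ac del: power_Suc)
  also have "\<dots> = distinct_fps L * ?f (2 * Suc L)"
    unfolding odd_fps_Suc Suc.IH ..
  also have "\<dots> = ?f (Suc L) * distinct_fps (Suc L)"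
    unfolding distinct_fps_Suc mult_2 power_add by (simp add: algebra_simps del: power_Suc)
  finally show ?case using one_minus_X_power_neq_0[of "Suc L"] by (metis mult_left_cancel zero_less_Suc)
qed

text \<open>This is \<open>h\<^sub>2\<close> in q^3, ..., q^(2L-1): the indices 1 \<le> k \<le> l
  encode the parts 2k+1 \<le> 2l+1, possibly equal.\<close>

definition pair_fps :: "nat \<Rightarrow> int fps" where
  "pair_fps L = (\<Sum>l<L. \<Sum>k=1..l. fps_X ^ ((2 * k + 1) + (2 * l + 1)))"

lemma sum_odd_powers:
  "(1 - fps_X ^ 2) * (\<Sum>k=1..l. fps_X ^ (2 * k + 1)) = fps_X ^ 3 * (1 - fps_X ^ (2 * l) :: int fps)"
proof (induction l)
  case (Suc l)
  have alg: "(1 - q\<^sup>2) * (S + y * q ^ 3) = q ^ 3 * (1 - y * q\<^sup>2)"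
    if "(1 - q\<^sup>2) * S = q ^ 3 * (1 - y)" for q y S :: "int fps"
    using that by algebra
  have "(\<Sum>k=1..Suc l. fps_X ^ (2 * k + 1))
      = (\<Sum>k=1..l. fps_X ^ (2 * k + 1)) + fps_X ^ (2 * l) * (fps_X ^ 3 :: int fps)"
    by (simp add: power_add[symmetric] eval_nat_numeral)
  moreover have "fps_X ^ (2 * Suc l) = fps_X ^ (2 * l) * (fps_X\<^sup>2 :: int fps)"
    by (simp add: power2_eq_square)
  ultimately show ?case using alg[OF Suc] by metis
qed simp

lemma pair_fps_Suc:
  "(1 - fps_X ^ 2) * (1 - fps_X ^ 4) * pair_fps (Suc L)
    = fps_X ^ 6 * (1 - fps_X ^ (2 * L)) * (1 - fps_X ^ (2 * L + 2))"
proof (induction L)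
  case 0
  then show ?case by (simp add: pair_fps_def)
next
  case (Suc L)
  \<comment> \<open>Here \<open>y\<close> is q^(2L), and q^3 y G collects the pairs whose larger
    part is 2L+3.\<close>
  have alg: "(1 - q\<^sup>2) * (1 - q ^ 4) * (H + q ^ 3 * y * G) = q ^ 6 * (1 - y * q\<^sup>2) * (1 - y * q ^ 4)"
    if "(1 - q\<^sup>2) * (1 - q ^ 4) * H = q ^ 6 * (1 - y) * (1 - y * q\<^sup>2)"
      "(1 - q\<^sup>2) * G = q ^ 3 * (1 - y * q\<^sup>2)" for q y H G :: "int fps"
    using that by algebra
  have e: "fps_X ^ (2 * Suc L) = fps_X ^ (2 * L) * (fps_X\<^sup>2 :: int fps)"
    "fps_X ^ (2 * Suc L + 2) = fps_X ^ (2 * L) * (fps_X ^ 4 :: int fps)"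
    "fps_X ^ (2 * L + 2) = fps_X ^ (2 * L) * (fps_X\<^sup>2 :: int fps)"
    by (simp_all add: power_add[symmetric] add.commute del: power_Suc)
  have "pair_fps (Suc (Suc L)) = pair_fps (Suc L)
      + (\<Sum>k=1..Suc L. fps_X ^ (2 * k + 1) * fps_X ^ (2 * Suc L + 1))"
    unfolding pair_fps_def power_add by (subst sum.lessThan_Suc) simp
  also have "(\<Sum>k=1..Suc L. fps_X ^ (2 * k + 1) * fps_X ^ (2 * Suc L + 1))
      = fps_X ^ 3 * fps_X ^ (2 * L) * (\<Sum>k=1..Suc L. fps_X ^ (2 * k + 1) :: int fps)"
    unfolding sum_distrib_right[symmetric] by (simp add: mult_ac power_add eval_nat_numeral)
  finally show ?case
    using alg[of fps_X "pair_fps (Suc L)" "fps_X ^ (2 * L)" "\<Sum>k=1..Suc L. fps_X ^ (2 * k + 1)"]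
      Suc sum_odd_powers[of "Suc L"] unfolding e by metis
qed

section \<open>Comparison of the generating functions\<close>

text \<open>Multiplying by (1 - q^2) (1 - q^4) makes both terms explicit. The result is split into
  \<open>R\<close> plus a multiple of 1 - q^2, so that the two factors can be divided out again one
  by one.\<close>

lemma nonneg_diff_pair_run: "nonneg (odd_fps L * pair_fps L - run_fps 2 L)"
proof (cases "3 \<le> L")
  case False
  have "run_fps 2 2 = 0"
    using run_fps_Suc_Suc[of 1 0] by (simp add: run_fps_small numeral_2_eq_2)
  then have "run_fps 2 L = 0"
    using False run_fps_small[of L 1] by (cases "L = 2") (auto simp: numeral_2_eq_2)
  moreover have "nonneg (odd_fps L)" by (simp add: nonneg_def odd_fps_def)
  moreover have "nonneg (pair_fps L)" unfolding pair_fps_def by (intro nonneg_intros)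
  ultimately show ?thesis by (simp add: nonneg_mult)
next
  case True
  then obtain M where L: "L = M + 3" by (metis le_Suc_ex add.commute)
  let ?q = "fps_X :: int fps"
  let ?D = "distinct_fps (Suc M)"
  let ?E = "odd_fps L * pair_fps L - run_fps 2 L"
  \<comment> \<open>The removed exponents are 2L-2 and 2L, the ones in the numerator of
    \<open>pair_fps L\<close>; both exceed L because L \<ge> 3.\<close>
  let ?J = "{L<..2 * L} - {2 * M + 4, 2 * M + 6}"
  define Q where "Q = odd_fps L * (1 - ?q ^ (2 * M + 4)) * (1 - ?q ^ (2 * M + 6))"
  have J: "{L<..2 * L} = insert (2 * M + 4) (insert (2 * M + 6) ?J)" using L by auto
  have "distinct_fps L = odd_fps L * (\<Prod>j\<in>insert (2 * M + 4) (insert (2 * M + 6) ?J). 1 - ?q ^ j)"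
    using odd_fps_eq_distinct_fps[of L] J by simp
  also have "\<dots> = Q * (\<Prod>j\<in>?J. 1 - ?q ^ j)"
    by (subst prod.insert, simp, simp)+ (simp add: Q_def mult_ac)
  finally have QJ: "distinct_fps L = Q * (\<Prod>j\<in>?J. 1 - ?q ^ j)" .
  \<comment> \<open>\<open>distinct_fps L\<close> is \<open>Q\<close> times the remaining factors,
    so \<open>Q\<close> dominates it.\<close>
  have Q: "nonneg (Q - distinct_fps L)"
    using nonneg_diff_prod[of ?J Q] nonneg_distinct_fps[of L] by (simp add: QJ[symmetric])
  \<comment> \<open>The left-hand side below has a negative coefficient, but one of \<open>M\<close> and \<open>M + 1\<close> is even, so the
    offending summand is divisible by \<open>1 - q\<^sup>2\<close> with nonnegative quotient.\<close>
  define c where "c = (M + 1) div 2"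
  obtain a b where ab: "?q ^ M + ?q ^ Suc M - ?q ^ M * ?q ^ Suc M = ?q ^ a + ?q ^ b * (1 - (?q\<^sup>2) ^ c)"
  proof (cases "even M")
    case True
    then have "M = 2 * c" by (auto simp: c_def)
    then have "(?q\<^sup>2) ^ c = ?q ^ M" by (simp add: power_mult[symmetric])
    then show ?thesis using that[of M "Suc M"] by (simp add: algebra_simps)
  next
    case False
    then have "Suc M = 2 * c" by (auto simp: c_def elim: oddE)
    then have "(?q\<^sup>2) ^ c = ?q ^ Suc M" by (simp only: power_mult[symmetric])
    then show ?thesis using that[of "Suc M" M] by (simp add: algebra_simps)
  qed
  \<comment> \<open>The bracket after \<open>?D\<close> consists of (1 + q^(M+2)) (1 + q^(M+3)) - 1,
    from \<open>distinct_fps L\<close> in terms of \<open>?D\<close>, and the harmless monomial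
    q^a.\<close>
  define R where "R = (Q - distinct_fps L) + ?D * (?q ^ (M + 2) + ?q ^ (M + 3) * (1 + ?q ^ (M + 2)) + ?q ^ a)"
  have R: "nonneg (?q ^ 6 * R)"
    unfolding R_def using Q nonneg_distinct_fps by (intro nonneg_intros)
  \<comment> \<open>The geometric sum is the quotient of 1 - q^(2c) by 1 - q^2.\<close>
  define T where "T = ?D * ?q ^ b * (\<Sum>i<c. (?q\<^sup>2) ^ i)"
  have T: "nonneg (?q ^ 6 * T)"
    unfolding T_def by (intro nonneg_intros nonneg_distinct_fps) (simp add: power_mult[symmetric] nonneg_X_power)
  have D: "distinct_fps L = ?D * (1 + ?q ^ (M + 2)) * (1 + ?q ^ (M + 3))"
    using distinct_fps_Suc[of "Suc M"] distinct_fps_Suc[of "Suc (Suc M)"]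
    by (simp add: L numeral_3_eq_3 numeral_2_eq_2)
  have "?E * (1 - ?q ^ 4) * (1 - ?q\<^sup>2) = ?q ^ 6 * (Q - ?D * (1 - ?q ^ Suc M) * (1 - ?q ^ M))"
  proof -
    have "(1 - ?q\<^sup>2) * (1 - ?q ^ 4) * pair_fps L = ?q ^ 6 * (1 - ?q ^ (2 * M + 4)) * (1 - ?q ^ (2 * M + 6))"
      using pair_fps_Suc[of "M + 2"] by (simp add: L eval_nat_numeral)
    moreover have "(1 - ?q\<^sup>2) * (1 - ?q ^ 4) * run_fps 2 L = ?q ^ 6 * ?D * (1 - ?q ^ Suc M) * (1 - ?q ^ M)"
      using run_fps_2[of M] L by simp
    moreover have "(P * H - B) * (1 - q4) * (1 - q2) = q6 * (P * u * v - D * w * x)"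
      if "(1 - q2) * (1 - q4) * H = q6 * u * v" "(1 - q2) * (1 - q4) * B = q6 * D * w * x"
      for P H B q4 q2 q6 u v w x D :: "int fps"
      using that by algebra
    ultimately show ?thesis unfolding Q_def by metis
  qed
  also have "Q - ?D * (1 - ?q ^ Suc M) * (1 - ?q ^ M) = R + ?D * ?q ^ b * (1 - (?q\<^sup>2) ^ c)"
  proof -
    have "Q - D * (1 - w) * (1 - x) = Q - D' + D * (u + v * (1 + u) + y) + D * z * t"
      if "x + w - x * w = y + z * t" "D' = D * (1 + u) * (1 + v)"
      for Q D D' u v w x y z t :: "int fps"
      using that by algebra
    then show ?thesis using ab D unfolding R_def by metis
  qed
  also have "\<dots> = R + T * (1 - ?q\<^sup>2)"
    unfolding one_diff_power_eq[of "?q\<^sup>2"] T_def by (simp add: mult_ac)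
  \<comment> \<open>Moving \<open>T\<close> to the left leaves a nonnegative right side; after
    division by 1 - q^2 it is added back before dividing by 1 - q^4.\<close>
  finally have eq: "(?E * (1 - ?q ^ 4) - ?q ^ 6 * T) * (1 - ?q ^ 2) = ?q ^ 6 * R"
    by (simp add: algebra_simps)
  then have "nonneg (?E * (1 - ?q ^ 4) - ?q ^ 6 * T)"
    using R nonneg_cancel[of "?E * (1 - ?q ^ 4) - ?q ^ 6 * T" 2] by simp
  from nonneg_add[OF this T] have "nonneg (?E * (1 - ?q ^ 4))" by simp
  then show ?thesis using nonneg_cancel by (metis zero_less_numeral)
qed

section \<open>From coefficients back to sums over partitions\<close>

lemma suminf_card_fibres:
  fixes f :: "'a \<Rightarrow> nat" and g :: "nat \<Rightarrow> nat"
  assumes "finite A"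
  shows "(\<Sum>m. g m * card {p \<in> A. f p = m}) = (\<Sum>p\<in>A. g (f p))"
proof -
  have "(\<Sum>m. g m * card {p \<in> A. f p = m}) = (\<Sum>m\<in>f ` A. g m * card {p \<in> A. f p = m})"
    using assms by (intro suminf_finite) (auto simp: card_eq_0_iff)
  also have "\<dots> = (\<Sum>p\<in>A. g (f p))"
    using sum_fun_comp[of A "f ` A" f g] assms by (simp add: mult.commute)
  finally show ?thesis .
qed

lemma choose2_mono: "m \<le> n \<Longrightarrow> m choose 2 \<le> n choose 2"
  by (simp add: choose_two div_le_mono mult_le_mono diff_le_mono)

text \<open>\<open>Inl s\<close> stands for the hook with arm 1 and \<open>Inr s\<close> for the hook with leg 1 in the rows of length
  \<open>s\<close>. Two distinct parts give two hooks of the former kind, a repeated part one of each kind.\<close>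

lemma pairs_le_choose_hooks:
  assumes p: "p \<in> odd_partitions L n"
  shows "card {(l, k). l < L \<and> k \<in> {1..l} \<and> {#2 * k + 1, 2 * l + 1#} \<subseteq># mset p} \<le> num_hooks 2 p choose 2"
    (is "card ?A \<le> _")
proof -
  let ?U = "large_parts (mset p) <+> repeated_parts (mset p)"
  let ?f = "\<lambda>(l, k). if k = l then {Inl (2 * l + 1), Inr (2 * l + 1)} else {Inl (2 * k + 1), Inl (2 * l + 1)}"
  have "card ?A \<le> card {B. B \<subseteq> ?U \<and> card B = 2}"
  proof (rule card_inj_on_le)
    show "inj_on ?f ?A"
      by (rule inj_onI) (auto simp: doubleton_eq_iff split: if_splits)
    have "2 * k + 1 \<in> large_parts (mset p)" "2 * l + 1 \<in> large_parts (mset p)"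
      "k = l \<longrightarrow> 2 * l + 1 \<in> repeated_parts (mset p)"
      if "k \<in> {1..l}" "{#2 * k + 1, 2 * l + 1#} \<subseteq># mset p" for k l
      using that mset_subset_eqD[OF that(2)] mset_subset_eq_count[OF that(2), of "2 * l + 1"]
      by (auto simp: large_parts_def repeated_parts_def)
    note parts = this
    show "?f ` ?A \<subseteq> {B. B \<subseteq> ?U \<and> card B = 2}"
    proof
      fix B assume "B \<in> ?f ` ?A"
      then obtain l k where B: "B = ?f (l, k)" and lk: "k \<in> {1..l}" "{#2 * k + 1, 2 * l + 1#} \<subseteq># mset p"
        by auto
      show "B \<in> {B. B \<subseteq> ?U \<and> card B = 2}"
        using parts[OF lk] B by (cases "k = l") auto
    qed
    show "finite {B. B \<subseteq> ?U \<and> card B = 2}" by (rule finite_subset[of _ "Pow ?U"]) auto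
  qed
  also have "\<dots> = card ?U choose 2" by (rule n_subsets) simp
  also have "\<dots> \<le> num_hooks 2 p choose 2"
    using p num_hooks_odd_ge[of p]
    by (intro choose2_mono) (auto simp: odd_partitions_def is_partition_def)
  finally show ?thesis .
qed

text \<open>Double counting: the coefficient counts the partitions together with a chosen
  two-element submultiset of parts at least 3.\<close>

lemma sum_choose_hooks_odd:
  "fps_nth (odd_fps L * pair_fps L) n \<le> int (\<Sum>p\<in>odd_partitions L n. num_hooks 2 p choose 2)"
proof -
  let ?I = "Sigma {..<L} (\<lambda>l. {1..l})"
  let ?N = "\<lambda>(l, k). {#2 * k + 1, 2 * l + 1#}"
  have "odd_fps L * pair_fps L = (\<Sum>i\<in>?I. fps_X ^ (\<Sum>\<^sub># (?N i)) * odd_fps L)"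
    by (simp add: pair_fps_def sum.Sigma sum_distrib_left mult.commute case_prod_unfold del: power_Suc)
  then have "fps_nth (odd_fps L * pair_fps L) n = (\<Sum>i\<in>?I. fps_nth (fps_X ^ (\<Sum>\<^sub># (?N i)) * odd_fps L) n)"
    by (simp add: fps_sum_nth)
  also have "\<dots> = (\<Sum>i\<in>?I. int (card {M \<in> odd_msets L n. ?N i \<subseteq># M}))"
    by (intro sum.cong refl card_odd_msets_supset[symmetric]) auto
  also have "\<dots> = int (\<Sum>i\<in>?I. card {M \<in> odd_msets L n. ?N i \<subseteq># M})" by simp
  also have "(\<Sum>i\<in>?I. card {M \<in> odd_msets L n. ?N i \<subseteq># M})
      = (\<Sum>M\<in>odd_msets L n. card {i \<in> ?I. ?N i \<subseteq># M})"
    using sum.swap_restrict[of ?I "odd_msets L n" "\<lambda>_ _. 1::nat" "\<lambda>i M. ?N i \<subseteq># M"]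
    by (simp add: finite_odd_msets)
  also have "\<dots> = (\<Sum>p\<in>odd_partitions L n. card {i \<in> ?I. ?N i \<subseteq># mset p})"
    unfolding mset_odd_partitions[symmetric]
    by (intro sum.reindex_cong[OF inj_on_subset[OF inj_on_mset_partitions[of n]]])
      (auto simp: odd_partitions_def)
  also have "\<dots> \<le> (\<Sum>p\<in>odd_partitions L n. num_hooks 2 p choose 2)"
  proof (rule sum_mono)
    fix p assume "p \<in> odd_partitions L n"
    moreover have "{i \<in> ?I. ?N i \<subseteq># mset p}
        = {(l, k). l < L \<and> k \<in> {1..l} \<and> {#2 * k + 1, 2 * l + 1#} \<subseteq># mset p}" by auto
    ultimately show "card {i \<in> ?I. ?N i \<subseteq># mset p} \<le> num_hooks 2 p choose 2"
      using pairs_le_choose_hooks by simp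
  qed
  finally show ?thesis by simp
qed

definition distinct_partitions :: "nat \<Rightarrow> nat \<Rightarrow> nat list set" where
  "distinct_partitions L n = {p. is_partition p n \<and> distinct p \<and> (\<forall>x\<in>set p. x \<le> L)}"

lemma finite_distinct_partitions: "finite (distinct_partitions L n)"
  by (rule finite_subset[OF _ finite_partitions[of n]]) (auto simp: distinct_partitions_def)

text \<open>A partition into distinct parts is determined by its set of parts. Since the summands
  are nonnegative, it suffices that these sets lie among the subsets of \<open>{1..L}\<close> with
  sum \<open>n\<close>.\<close>

lemma sum_choose_hooks_distinct:
  "int (\<Sum>p\<in>distinct_partitions L n. num_hooks 2 p choose 2) \<le> fps_nth (run_fps 2 L) n"
proof -
  let ?S = "{S \<in> Pow {1..L}. \<Sum>S = n}"
  have inj: "inj_on set (distinct_partitions L n)"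
    by (rule inj_onI) (auto simp: distinct_partitions_def set_eq_iff_mset_eq_distinct
        intro!: inj_onD[OF inj_on_mset_partitions[of n]])
  have "(\<Sum>p\<in>distinct_partitions L n. num_hooks 2 p choose 2)
      \<le> (\<Sum>p\<in>distinct_partitions L n. card (run_starts (set p)) choose 2)"
    by (intro sum_mono choose2_mono num_hooks_distinct_le)
      (auto simp: distinct_partitions_def is_partition_def)
  also have "\<dots> = (\<Sum>S\<in>set ` distinct_partitions L n. card (run_starts S) choose 2)"
    by (simp add: sum.reindex[OF inj])
  also have "\<dots> \<le> (\<Sum>S\<in>?S. card (run_starts S) choose 2)"
  proof (rule sum_mono2)
    show "set ` distinct_partitions L n \<subseteq> ?S"
      by (fastforce simp: distinct_partitions_def is_partition_def Suc_le_eq distinct_sum_list_conv_Sum)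
  qed auto
  finally have "int (\<Sum>p\<in>distinct_partitions L n. num_hooks 2 p choose 2)
      \<le> int (\<Sum>S\<in>?S. card (run_starts S) choose 2)" by (rule of_nat_mono)
  also have "\<dots> = (\<Sum>S\<in>Pow {1..L}. if \<Sum>S = n then int (card (run_starts S) choose 2) else 0)"
    by (subst sum.inter_filter[symmetric]) simp_all
  also have "\<dots> = fps_nth (run_fps 2 L) n"
    unfolding run_fps_def fps_sum_nth
    by (intro sum.cong refl) (simp add: fps_of_nat[symmetric] fps_X_power_nth)
  finally show ?thesis .
qed

theorem corollary1p6:
  fixes L n :: nat
  assumes "L \<ge> 1"
  shows "(\<Sum>m. (m choose 2) * a2 L m n) \<ge> (\<Sum>m. (m choose 2) * b2 L m n)"
proof -
  have "a2 L m n = card {p \<in> odd_partitions L n. num_hooks 2 p = m}" for m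
    by (simp add: a2_def odd_partitions_def conj_ac)
  then have A: "(\<Sum>m. (m choose 2) * a2 L m n) = (\<Sum>p\<in>odd_partitions L n. num_hooks 2 p choose 2)"
    using suminf_card_fibres[OF finite_odd_partitions, of "\<lambda>m. m choose 2"] by simp
  have "b2 L m n = card {p \<in> distinct_partitions L n. num_hooks 2 p = m}" for m
    by (simp add: b2_def distinct_partitions_def conj_ac)
  then have B: "(\<Sum>m. (m choose 2) * b2 L m n) = (\<Sum>p\<in>distinct_partitions L n. num_hooks 2 p choose 2)"
    using suminf_card_fibres[OF finite_distinct_partitions, of "\<lambda>m. m choose 2"] by simp
  have "int (\<Sum>p\<in>distinct_partitions L n. num_hooks 2 p choose 2) \<le> fps_nth (run_fps 2 L) n"
    by (rule sum_choose_hooks_distinct)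
  also have "\<dots> \<le> fps_nth (odd_fps L * pair_fps L) n"
    using nonneg_diff_pair_run[of L] by (simp add: nonneg_def)
  also have "\<dots> \<le> int (\<Sum>p\<in>odd_partitions L n. num_hooks 2 p choose 2)"
    by (rule sum_choose_hooks_odd)
  finally show ?thesis unfolding A B of_nat_le_iff .
qed

end
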